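(* For every $d\geq 1$, there exists a simple connected $2d$-regular vertex-transitive graph $G$ that has no $\mathrm{Aut}(G)$-factor of iid balanced orientation. In particular, $G$ has no $\mathrm{Aut}(G)$-factor of iid Schreier decoration.
   Context: **Balanced orientation.** An orientation of the edges of a graph with all degrees even is balanced if the indegree of every vertex equals its outdegree. **Schreier decoration.** For a simple connected $2d$-regular graph $G$, a Schreier decoration of $G$ is a colouring of the edges with $d$ colours together with an orientation of the edges such that at every vertex there is exactly one incoming and exactly one outgoing edge of each colour. **Factors of iid.** $\mathrm{Aut}(G)$ is the full graph automorphism group; it acts on $[0,1]^{V(G)}$ (equipped with the product of Lebesgue measures) by $(\gamma.f)(v)=f(\gamma^{-1}.v)$, and naturally on the measurable spaces of balanced orientations and of Schreier decorations of $G$. An $\mathrm{Aut}(G)$-factor of iid balanced orientation (resp. Schreier decoration) is a measurable map $\Phi$, defined on $[0,1]^{V(G)}$ up to a null set, with values in the space of balanced orientations (resp. Schreier decorations) of $G$, that is $\mathrm{Aut}(G)$-equivariant: $\gamma.\Phi(\omega)=\Phi(\gamma.\omega)$ for all $\gamma\in\mathrm{Aut}(G)$. *)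

theory Defs
  imports "HOL-Probability.Probability"
begin

section \<open>Graphs\<close>

text \<open>A graph is given by a set V of vertices and a set E of edges, an edge being the set of its
  two endpoints.\<close>

definition simple_graph :: "'v set \<Rightarrow> 'v set set \<Rightarrow> bool" where
  "simple_graph V E \<longleftrightarrow> (\<forall>e\<in>E. e \<subseteq> V \<and> card e = 2)"

definition incident_edges :: "'v set set \<Rightarrow> 'v \<Rightarrow> 'v set set" where
  "incident_edges E v = {e \<in> E. v \<in> e}"

definition regular_graph :: "'v set \<Rightarrow> 'v set set \<Rightarrow> nat \<Rightarrow> bool" where
  "regular_graph V E k \<longleftrightarrow>
     (\<forall>v\<in>V. finite (incident_edges E v) \<and> card (incident_edges E v) = k)"

definition connected_graph :: "'v set \<Rightarrow> 'v set set \<Rightarrow> bool" where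
  "connected_graph V E \<longleftrightarrow> V \<noteq> {} \<and> (\<forall>u\<in>V. \<forall>v\<in>V. (u, v) \<in> {(x, y). {x, y} \<in> E}\<^sup>*)"

text \<open>Automorphisms are total functions whose values outside V are arbitrary; nothing below
  depends on those values.\<close>

definition graph_automorphisms :: "'v set \<Rightarrow> 'v set set \<Rightarrow> ('v \<Rightarrow> 'v) set" where
  "graph_automorphisms V E =
     {\<gamma>. bij_betw \<gamma> V V \<and> (\<forall>u\<in>V. \<forall>v\<in>V. {\<gamma> u, \<gamma> v} \<in> E \<longleftrightarrow> {u, v} \<in> E)}"

definition vertex_transitive :: "'v set \<Rightarrow> 'v set set \<Rightarrow> bool" where
  "vertex_transitive V E \<longleftrightarrow> (\<forall>u\<in>V. \<forall>v\<in>V. \<exists>\<gamma>\<in>graph_automorphisms V E. \<gamma> u = v)"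


section \<open>Balanced orientations\<close>

text \<open>An orientation is encoded as the function h that assigns to each edge its head, so that
  the edge e = {u, v} with h e = v points from u to v. The space of all orientations is thus the
  product of the two-point spaces e over all edges e. Only the sigma-algebra of this and of the
  following spaces of structures is used, never their measure.\<close>

definition orientation_space :: "'v set set \<Rightarrow> ('v set \<Rightarrow> 'v) measure" where
  "orientation_space E = PiM E (\<lambda>e. count_space e)"

definition in_edges :: "'v set set \<Rightarrow> ('v set \<Rightarrow> 'v) \<Rightarrow> 'v \<Rightarrow> 'v set set" where
  "in_edges E h v = {e \<in> incident_edges E v. h e = v}"

definition out_edges :: "'v set set \<Rightarrow> ('v set \<Rightarrow> 'v) \<Rightarrow> 'v \<Rightarrow> 'v set set" where
  "out_edges E h v = {e \<in> incident_edges E v. h e \<noteq> v}"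

definition balanced :: "'v set \<Rightarrow> 'v set set \<Rightarrow> ('v set \<Rightarrow> 'v) \<Rightarrow> bool" where
  "balanced V E h \<longleftrightarrow> (\<forall>v\<in>V. card (in_edges E h v) = card (out_edges E h v))"

definition balanced_orientation_space ::
    "'v set \<Rightarrow> 'v set set \<Rightarrow> ('v set \<Rightarrow> 'v) measure" where
  "balanced_orientation_space V E = restrict_space (orientation_space E) {h. balanced V E h}"


section \<open>Schreier decorations\<close>

text \<open>The pair (c, h) consists of a colouring c of the edges with the d colours 0, ..., d - 1 and
  an orientation h.\<close>

definition schreier :: "'v set \<Rightarrow> 'v set set \<Rightarrow> nat \<Rightarrow> ('v set \<Rightarrow> nat) \<times> ('v set \<Rightarrow> 'v) \<Rightarrow> bool" where
  "schreier V E d = (\<lambda>(c, h). \<forall>v\<in>V. \<forall>i<d.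
     (\<exists>!e. e \<in> in_edges E h v \<and> c e = i) \<and> (\<exists>!e. e \<in> out_edges E h v \<and> c e = i))"

definition schreier_decoration_space ::
    "'v set \<Rightarrow> 'v set set \<Rightarrow> nat \<Rightarrow> (('v set \<Rightarrow> nat) \<times> ('v set \<Rightarrow> 'v)) measure" where
  "schreier_decoration_space V E d =
     restrict_space (PiM E (\<lambda>_. count_space {..<d}) \<Otimes>\<^sub>M orientation_space E)
       {s. schreier V E d s}"


section \<open>Actions of the automorphism group\<close>

text \<open>Elements of a product space over an index set are extensional functions in the library, so
  the results are restricted to the index set.\<close>

definition act_label :: "'v set \<Rightarrow> ('v \<Rightarrow> 'v) \<Rightarrow> ('v \<Rightarrow> 'b) \<Rightarrow> 'v \<Rightarrow> 'b" where
  "act_label V \<gamma> f = (\<lambda>v\<in>V. f (inv_into V \<gamma> v))"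

definition act_colouring ::
    "'v set \<Rightarrow> 'v set set \<Rightarrow> ('v \<Rightarrow> 'v) \<Rightarrow> ('v set \<Rightarrow> 'b) \<Rightarrow> 'v set \<Rightarrow> 'b" where
  "act_colouring V E \<gamma> c = (\<lambda>e\<in>E. c (inv_into V \<gamma> ` e))"

definition act_orientation ::
    "'v set \<Rightarrow> 'v set set \<Rightarrow> ('v \<Rightarrow> 'v) \<Rightarrow> ('v set \<Rightarrow> 'v) \<Rightarrow> 'v set \<Rightarrow> 'v" where
  "act_orientation V E \<gamma> h = (\<lambda>e\<in>E. \<gamma> (h (inv_into V \<gamma> ` e)))"

definition act_decoration ::
    "'v set \<Rightarrow> 'v set set \<Rightarrow> ('v \<Rightarrow> 'v) \<Rightarrow> ('v set \<Rightarrow> 'b) \<times> ('v set \<Rightarrow> 'v)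
      \<Rightarrow> ('v set \<Rightarrow> 'b) \<times> ('v set \<Rightarrow> 'v)" where
  "act_decoration V E \<gamma> = map_prod (act_colouring V E \<gamma>) (act_orientation V E \<gamma>)"


section \<open>Factors of iid\<close>

definition iid_labels :: "'v set \<Rightarrow> ('v \<Rightarrow> real) measure" where
  "iid_labels V = PiM V (\<lambda>_. restrict_space lborel {0..1})"

text \<open>The map \<Phi> is defined on the conull set X, with values in the space M carrying the action
  act. As \<Phi> is only determined up to a null set, the equivariance identity for each
  automorphism is one between maps defined almost everywhere; the null set may depend on the
  automorphism. Since the action on labels preserves the measure, almost every \<omega> satisfies both
  \<omega> \<in> X and \<gamma>.\<omega> \<in> X, so the values of \<Phi> outside X play no role.\<close>

definition is_factor_of_iid ::
    "'v set \<Rightarrow> 'v set set \<Rightarrow> 's measure \<Rightarrow> (('v \<Rightarrow> 'v) \<Rightarrow> 's \<Rightarrow> 's)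
      \<Rightarrow> ('v \<Rightarrow> real) set \<Rightarrow> (('v \<Rightarrow> real) \<Rightarrow> 's) \<Rightarrow> bool" where
  "is_factor_of_iid V E M act X \<Phi> \<longleftrightarrow>
     X \<in> sets (iid_labels V) \<and> (AE \<omega> in iid_labels V. \<omega> \<in> X) \<and>
     \<Phi> \<in> measurable (restrict_space (iid_labels V) X) M \<and>
     (\<forall>\<gamma>\<in>graph_automorphisms V E.
        AE \<omega> in iid_labels V. act \<gamma> (\<Phi> \<omega>) = \<Phi> (act_label V \<gamma> \<omega>))"

definition has_factor_of_iid_balanced_orientation :: "'v set \<Rightarrow> 'v set set \<Rightarrow> bool" where
  "has_factor_of_iid_balanced_orientation V E \<longleftrightarrow>
     (\<exists>X \<Phi>. is_factor_of_iid V E (balanced_orientation_space V E) (act_orientation V E) X \<Phi>)"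

definition has_factor_of_iid_schreier_decoration :: "'v set \<Rightarrow> 'v set set \<Rightarrow> nat \<Rightarrow> bool" where
  "has_factor_of_iid_schreier_decoration V E d \<longleftrightarrow>
     (\<exists>X \<Phi>. is_factor_of_iid V E (schreier_decoration_space V E d) (act_decoration V E) X \<Phi>)"

end

theory Submission
  imports Defs
begin

text \<open>The graph is a Cayley graph of the integers whose set S of positive steps contains 1 and has odd
sum, namely S = {1} \<union> {2, 4, ..., 2d - 2}.

In a balanced orientation the net flow through the cut between the integers up to n and those
above n does not depend on n, since passing from n to n + 1 changes it by the difference of
outdegree and indegree at n + 1 (flow_const). The cut consists of as many edges as the sum of S,
an odd number, so the flow is odd and in particular nonzero (odd_flow). Every balanced orientation
thus selects one of the two ends of the graph: the one towards which it flows. Translations preserve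
this choice and the reflection x \<mapsto> -x reverses it (flow_translation, flow_reflection).

For a factor of iid, the event that the flow is positive is therefore almost surely invariant under
translations. Such events have probability 0 or 1, because an event is approximable by events
that depend on finitely many labels, and a far translate of such an event is independent of it
(invariant_event_prob_0_or_1). On the other hand the reflection preserves the law of the
labels and maps the event to its complement, so the probability is 1/2, a contradiction.

A Schreier decoration has a balanced orientation as its second component, so its existence as a
factor is excluded as well (balanced_factor_of_schreier_factor).\<close>

section \<open>A zero-one law for product measures\<close>

lemma sym_diff_prob_bounds:
  assumes "prob_space P" "A \<in> sets P" "B \<in> sets P"
  shows "\<bar>measure P A - measure P B\<bar> \<le> measure P (sym_diff A B)"
proof -
  interpret prob_space P by fact
  have "prob A \<le> prob (B \<union> sym_diff A B)" "prob B \<le> prob (A \<union> sym_diff A B)"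
    using assms by (auto intro!: finite_measure_mono)
  moreover have "prob (B \<union> sym_diff A B) \<le> prob B + prob (sym_diff A B)"
    "prob (A \<union> sym_diff A B) \<le> prob A + prob (sym_diff A B)"
    using assms by (intro measure_Un_le; auto)+
  ultimately show ?thesis by linarith
qed

text \<open>The approximating event is the cylinder over an event B of a finite subproduct, which keeps its
dependence on finitely many coordinates explicit; the distance is the measure of the symmetric
difference.\<close>
definition finitely_approximable :: "'i set \<Rightarrow> ('i \<Rightarrow> 'a measure) \<Rightarrow> ('i \<Rightarrow> 'a) set \<Rightarrow> bool" where
  "finitely_approximable I M A \<longleftrightarrow> (\<forall>\<epsilon>>0. \<exists>J B. finite J \<and> J \<subseteq> I \<and> B \<in> sets (PiM J M) \<and>
     measure (PiM I M) (sym_diff A (prod_emb I M J B)) < \<epsilon>)"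

lemma finitely_approximableE:
  assumes "finitely_approximable I M A" "\<epsilon> > 0"
  obtains J B where "finite J" "J \<subseteq> I" "B \<in> sets (PiM J M)"
    "measure (PiM I M) (sym_diff A (prod_emb I M J B)) < \<epsilon>"
  using assms unfolding finitely_approximable_def by meson

lemma finitely_approximable_Un:
  assumes M: "\<And>i. prob_space (M i)"
    and meas: "A \<in> sets (PiM I M)" "A' \<in> sets (PiM I M)"
    and A: "finitely_approximable I M A" and A': "finitely_approximable I M A'"
  shows "finitely_approximable I M (A \<union> A')"
  unfolding finitely_approximable_def
proof (intro allI impI)
  fix \<epsilon> :: real assume "\<epsilon> > 0"
  then have e2: "\<epsilon> / 2 > 0" by simp
  interpret P: prob_space "PiM I M" by (rule prob_space_PiM) (rule M)
  obtain J B where J: "finite J" "J \<subseteq> I" "B \<in> sets (PiM J M)"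
    and B: "P.prob (sym_diff A (prod_emb I M J B)) < \<epsilon> / 2"
    by (rule finitely_approximableE[OF A e2])
  obtain J' B' where J': "finite J'" "J' \<subseteq> I" "B' \<in> sets (PiM J' M)"
    and B': "P.prob (sym_diff A' (prod_emb I M J' B')) < \<epsilon> / 2"
    by (rule finitely_approximableE[OF A' e2])
  define C where "C = prod_emb (J \<union> J') M J B \<union> prod_emb (J \<union> J') M J' B'"
  have C: "C \<in> sets (PiM (J \<union> J') M)"
    unfolding C_def using J J' by (intro sets.Un measurable_prod_emb) auto
  have emb: "prod_emb I M (J \<union> J') C = prod_emb I M J B \<union> prod_emb I M J' B'"
    unfolding C_def using J J' by (simp add: prod_emb_Un)
  have m: "prod_emb I M J B \<in> sets (PiM I M)" "prod_emb I M J' B' \<in> sets (PiM I M)"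
    using J J' by (auto intro!: measurable_prod_emb)
  have "P.prob (sym_diff (A \<union> A') (prod_emb I M (J \<union> J') C))
      \<le> P.prob (sym_diff A (prod_emb I M J B) \<union> sym_diff A' (prod_emb I M J' B'))"
    unfolding emb using meas m by (intro P.finite_measure_mono) auto
  also have "\<dots> \<le> P.prob (sym_diff A (prod_emb I M J B)) + P.prob (sym_diff A' (prod_emb I M J' B'))"
    using meas m by (intro measure_Un_le) auto
  also have "\<dots> < \<epsilon>" using B B' by linarith
  finally show "\<exists>J B. finite J \<and> J \<subseteq> I \<and> B \<in> sets (PiM J M) \<and>
     P.prob (sym_diff (A \<union> A') (prod_emb I M J B)) < \<epsilon>"
    using J J' C by (intro exI[of _ "J \<union> J'"] exI[of _ C]) auto
qed

text \<open>The approximable events contain the one-coordinate cylinders that generate the sigma-algebra, so it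
suffices that they are closed under complements, which have the same symmetric difference, and
under countable unions, which are approached in measure by their finite partial unions.\<close>
lemma finitely_approximable_event:
  assumes M: "\<And>i. prob_space (M i)" and A: "A \<in> sets (PiM I M)"
  shows "finitely_approximable I M A"
proof -
  interpret P: prob_space "PiM I M" by (rule prob_space_PiM) (rule M)
  let ?G = "{{f \<in> \<Pi>\<^sub>E i\<in>I. space (M i). f i \<in> A} | i A. i \<in> I \<and> A \<in> sets (M i)}"
  have setsP: "sigma_sets (\<Pi>\<^sub>E i\<in>I. space (M i)) ?G = sets (PiM I M)"
    by (simp add: sets_PiM_single)
  have "A \<in> sigma_sets (\<Pi>\<^sub>E i\<in>I. space (M i)) ?G"
    using A by (simp add: setsP)
  then show ?thesis
  proof (induction rule: sigma_sets.induct)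
    case (Basic a)
    then obtain i C where i: "i \<in> I" and C: "C \<in> sets (M i)"
      and a: "a = {f \<in> \<Pi>\<^sub>E i\<in>I. space (M i). f i \<in> C}"
      by blast
    have "a = prod_emb I M {i} (\<Pi>\<^sub>E j\<in>{i}. C)"
      using i C a sets.sets_into_space[of C "M i"]
      by (auto simp: prod_emb_def PiE_iff extensional_def restrict_def split: if_splits)
    moreover have "(\<Pi>\<^sub>E j\<in>{i}. C) \<in> sets (PiM {i} M)"
      using C by (intro sets_PiM_I_finite) auto
    ultimately show ?case
      unfolding finitely_approximable_def using i
      by (intro allI impI exI[of _ "{i}"] exI[of _ "\<Pi>\<^sub>E j\<in>{i}. C"]) auto
  next
    case Empty
    show ?case
      unfolding finitely_approximable_def
      by (intro allI impI exI[of _ "{}"]) auto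
  next
    case (Compl a)
    have a: "a \<in> sets (PiM I M)" using Compl.hyps setsP by simp
    show ?case
      unfolding finitely_approximable_def
    proof (intro allI impI)
      fix \<epsilon> :: real assume \<epsilon>: "\<epsilon> > 0"
      obtain J B where J: "finite J" "J \<subseteq> I" "B \<in> sets (PiM J M)"
        and B: "P.prob (sym_diff a (prod_emb I M J B)) < \<epsilon>"
        by (rule finitely_approximableE[OF Compl.IH \<epsilon>])
      have "prod_emb I M J B \<in> sets (PiM I M)" using J by (auto intro!: measurable_prod_emb)
      then have sub: "prod_emb I M J B \<subseteq> (\<Pi>\<^sub>E i\<in>I. space (M i))" "a \<subseteq> (\<Pi>\<^sub>E i\<in>I. space (M i))"
        using sets.sets_into_space[of _ "PiM I M"] a by (simp_all add: space_PiM)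
      have "prod_emb I M J (space (PiM J M) - B) = (\<Pi>\<^sub>E i\<in>I. space (M i)) - prod_emb I M J B"
        using J(2) by (auto simp: prod_emb_def space_PiM PiE_iff subset_iff)
      then have "sym_diff ((\<Pi>\<^sub>E i\<in>I. space (M i)) - a) (prod_emb I M J (space (PiM J M) - B))
        = sym_diff a (prod_emb I M J B)"
        using sub by auto
      with B J show "\<exists>J B. finite J \<and> J \<subseteq> I \<and> B \<in> sets (PiM J M) \<and>
         P.prob (sym_diff ((\<Pi>\<^sub>E i\<in>I. space (M i)) - a) (prod_emb I M J B)) < \<epsilon>"
        by (intro exI[of _ J] exI[of _ "space (PiM J M) - B"]) auto
    qed
  next
    case (Union a)
    have a: "a n \<in> sets (PiM I M)" for n using Union.hyps setsP by simp
    define b where "b n = (\<Union>k<n. a k)" for n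
    have b: "b n \<in> sets (PiM I M)" for n unfolding b_def using a by auto
    have fin: "finitely_approximable I M (b n)" for n
    proof (induction n)
      case 0
      show ?case
        unfolding finitely_approximable_def b_def
        by (intro allI impI exI[of _ "{}"]) auto
    next
      case (Suc n)
      have "b (Suc n) = b n \<union> a n" unfolding b_def by (auto simp: less_Suc_eq)
      then show ?case
        using finitely_approximable_Un[OF M b a Suc Union.IH] by simp
    qed
    let ?U = "\<Union>i. a i"
    have U: "?U \<in> sets (PiM I M)" using a by auto
    have "incseq b" unfolding b_def incseq_def by fastforce
    moreover have "(\<Union>n. b n) = ?U" unfolding b_def by auto
    ultimately have lim: "(\<lambda>n. P.prob (b n)) \<longlonglongrightarrow> P.prob ?U"
      using P.finite_Lim_measure_incseq[of b] b by auto
    show ?case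
      unfolding finitely_approximable_def
    proof (intro allI impI)
      fix \<epsilon> :: real assume "\<epsilon> > 0"
      then have e2: "\<epsilon> / 2 > 0" by simp
      then have "\<forall>\<^sub>F n in sequentially. P.prob ?U - \<epsilon> / 2 < P.prob (b n)"
        by (intro order_tendstoD(1)[OF lim]) auto
      then obtain n where n: "P.prob ?U - \<epsilon> / 2 < P.prob (b n)"
        by (auto simp: eventually_sequentially)
      have "b n \<subseteq> ?U" unfolding b_def by auto
      then have d: "P.prob (?U - b n) < \<epsilon> / 2"
        using n P.finite_measure_Diff[OF U b] by auto
      obtain J B where J: "finite J" "J \<subseteq> I" "B \<in> sets (PiM J M)"
        and B: "P.prob (sym_diff (b n) (prod_emb I M J B)) < \<epsilon> / 2"
        by (rule finitely_approximableE[OF fin[of n] e2])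
      have m: "prod_emb I M J B \<in> sets (PiM I M)" using J by (auto intro!: measurable_prod_emb)
      have "P.prob (sym_diff ?U (prod_emb I M J B))
        \<le> P.prob ((?U - b n) \<union> sym_diff (b n) (prod_emb I M J B))"
        using U m b[of n] \<open>b n \<subseteq> ?U\<close> by (intro P.finite_measure_mono) auto
      also have "\<dots> \<le> P.prob (?U - b n) + P.prob (sym_diff (b n) (prod_emb I M J B))"
        using U m b[of n] by (intro measure_Un_le) auto
      also have "\<dots> < \<epsilon>" using d B by linarith
      finally show "\<exists>J B. finite J \<and> J \<subseteq> I \<and> B \<in> sets (PiM J M) \<and>
         P.prob (sym_diff ?U (prod_emb I M J B)) < \<epsilon>"
        using J by blast
    qed
  qed
qed

lemma indep_coordinate_blocks:
  assumes M: "\<And>i. prob_space (M i)" and I: "I \<noteq> {}" and JK: "J \<inter> K = {}" "J \<subseteq> I" "K \<subseteq> I"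
  shows "prob_space.indep_var (PiM I M) (PiM J M) (\<lambda>\<omega>. restrict \<omega> J) (PiM K M) (\<lambda>\<omega>. restrict \<omega> K)"
proof -
  interpret P: prob_space "PiM I M" by (rule prob_space_PiM) (rule M)
  have "P.indep_vars M (\<lambda>i \<omega>. \<omega> i) I"
  proof (subst P.indep_vars_iff_distr_eq_PiM'[OF I])
    show "(\<lambda>\<omega>. \<omega> i) \<in> measurable (PiM I M) (M i)" if "i \<in> I" for i
      using that by simp
    have "distr (PiM I M) (PiM I M) (\<lambda>x. \<lambda>i\<in>I. x i) = distr (PiM I M) (PiM I M) (\<lambda>x. x)"
      by (intro distr_cong) (auto simp: space_PiM PiE_iff extensional_restrict)
    also have "\<dots> = PiM I M" by simp
    also have "\<dots> = PiM I (\<lambda>i. distr (PiM I M) (M i) (\<lambda>\<omega>. \<omega> i))"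
      by (intro PiM_cong) (simp_all add: distr_PiM_component[of I M] M)
    finally show "distr (PiM I M) (PiM I M) (\<lambda>x. \<lambda>i\<in>I. x i) =
      PiM I (\<lambda>i. distr (PiM I M) (M i) (\<lambda>\<omega>. \<omega> i))" .
  qed
  from P.indep_var_restrict[OF this JK] show ?thesis by (simp add: restrict_def)
qed

text \<open>Reading iid labels along an injection of the index set gives iid labels with the same law. This is
stated in the form without restriction operators that is available when the index set is the whole type.\<close>
lemma distr_PiM_relabel:
  fixes f :: "'i \<Rightarrow> 'i" and N :: "'a measure"
  assumes "prob_space N" "inj f"
  shows "distr (PiM UNIV (\<lambda>_. N)) (PiM UNIV (\<lambda>_. N)) (\<lambda>\<omega> i. \<omega> (f i)) = PiM UNIV (\<lambda>_. N)"
  using distr_PiM_reindex[of UNIV "\<lambda>_. N" f UNIV] assms by (simp add: restrict_UNIV)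

lemma measurable_relabel:
  "(\<lambda>\<omega> i. \<omega> (f i)) \<in> measurable (PiM UNIV (\<lambda>_. N)) (PiM UNIV (\<lambda>_. N))"
  by (rule measurable_PiM_single') (auto simp: space_PiM PiE_iff)

lemma sets_relabel:
  assumes "A \<in> sets (PiM UNIV (\<lambda>_. N))"
  shows "{\<omega> \<in> space (PiM UNIV (\<lambda>_. N)). (\<lambda>i. \<omega> (f i)) \<in> A} \<in> sets (PiM UNIV (\<lambda>_. N))"
  using measurable_sets[OF measurable_relabel assms, of f] by (simp add: vimage_def Int_def conj_commute)

lemma measure_relabel:
  fixes f :: "'i \<Rightarrow> 'i" and N :: "'a measure"
  defines "P \<equiv> PiM UNIV (\<lambda>_. N)"
  assumes "prob_space N" "inj f" "A \<in> sets P"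
  shows "measure P {\<omega> \<in> space P. (\<lambda>i. \<omega> (f i)) \<in> A} = measure P A"
proof -
  have "measure P A = measure (distr P P (\<lambda>\<omega> i. \<omega> (f i))) A"
    unfolding P_def using distr_PiM_relabel[OF assms(2,3)] by simp
  also have "\<dots> = measure P ((\<lambda>\<omega> i. \<omega> (f i)) -` A \<inter> space P)"
    using assms(4) unfolding P_def by (intro measure_distr measurable_relabel)
  also have "(\<lambda>\<omega> i. \<omega> (f i)) -` A \<inter> space P = {\<omega> \<in> space P. (\<lambda>i. \<omega> (f i)) \<in> A}" by auto
  finally show ?thesis by simp
qed

text \<open>Let B approximate A and depend only on the coordinates in J. Then B and its translate
along f are independent, as they depend on disjoint sets of coordinates, and by invariance both are close
to A. So P(A) is close to the probability of their intersection, which is the square of P(B), hence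
close to the square of P(A). In the limit P(A) equals its own square.\<close>
lemma invariant_event_prob_0_or_1:
  fixes N :: "'a measure" and A :: "('i \<Rightarrow> 'a) set"
  defines "P \<equiv> PiM UNIV (\<lambda>_. N)"
  assumes N: "prob_space N" and A: "A \<in> sets P"
    and move: "\<And>J. finite J \<Longrightarrow>
      \<exists>f. inj f \<and> f ` J \<inter> J = {} \<and> (AE \<omega> in P. (\<lambda>i. \<omega> (f i)) \<in> A \<longleftrightarrow> \<omega> \<in> A)"
  shows "measure P A = 0 \<or> measure P A = 1"
proof -
  interpret P: prob_space P unfolding P_def by (rule prob_space_PiM) (rule N)
  let ?p = "P.prob A"
  have bound: "\<bar>?p - ?p\<^sup>2\<bar> \<le> \<epsilon>" if "\<epsilon> > 0" for \<epsilon>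
  proof -
    have "\<epsilon> / 4 > 0" using that by simp
    moreover have "finitely_approximable UNIV (\<lambda>_. N) A"
      using finitely_approximable_event[of "\<lambda>_. N" A UNIV] N A unfolding P_def by simp
    ultimately obtain J B' where J: "finite J" "B' \<in> sets (PiM J (\<lambda>_. N))"
      and close: "P.prob (sym_diff A (prod_emb UNIV (\<lambda>_. N) J B')) < \<epsilon> / 4"
      unfolding P_def using finitely_approximableE by metis
    define B where "B = prod_emb UNIV (\<lambda>_. N) J B'"
    have B: "B \<in> sets P" unfolding B_def P_def using J by (intro measurable_prod_emb) auto
    obtain f where f: "inj f" "f ` J \<inter> J = {}"
      and inv: "AE \<omega> in P. (\<lambda>i. \<omega> (f i)) \<in> A \<longleftrightarrow> \<omega> \<in> A"
      using move[OF J(1)] by blast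
    define T where "T S = {\<omega> \<in> space P. (\<lambda>i. \<omega> (f i)) \<in> S}" for S :: "('i \<Rightarrow> 'a) set"
    have T_meas: "T S \<in> sets P" if "S \<in> sets P" for S
      using that unfolding T_def P_def by (rule sets_relabel)
    have T_prob: "P.prob (T S) = P.prob S" if "S \<in> sets P" for S
      using that measure_relabel[OF N f(1), of S] unfolding T_def P_def by simp
    have indep: "P.prob (B \<inter> T B) = P.prob B * P.prob (T B)"
    proof -
      \<comment> \<open>The shifted event, written as a cylinder over the coordinates in f ` J.\<close>
      define C where "C = {x \<in> space (PiM (f ` J) (\<lambda>_. N)). (\<lambda>j\<in>J. x (f j)) \<in> B'}"
      have "(\<lambda>x. \<lambda>j\<in>J. x (f j)) \<in> measurable (PiM (f ` J) (\<lambda>_. N)) (PiM J (\<lambda>_. N))"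
        by (intro measurable_restrict) auto
      from measurable_sets[OF this J(2)] have C: "C \<in> sets (PiM (f ` J) (\<lambda>_. N))"
        unfolding C_def by (simp add: vimage_def Int_def conj_commute)
      have B_eq: "B = (\<lambda>\<omega>. restrict \<omega> J) -` B' \<inter> space P"
        unfolding B_def P_def prod_emb_def by (simp add: space_PiM)
      have TB_eq: "T B = (\<lambda>\<omega>. restrict \<omega> (f ` J)) -` C \<inter> space P"
        unfolding B_eq T_def C_def P_def
        by (auto simp: space_PiM PiE_iff cong: restrict_cong)
      have "P.prob ((\<lambda>\<omega>. (restrict \<omega> J, restrict \<omega> (f ` J))) -` (B' \<times> C) \<inter> space P)
          = P.prob ((\<lambda>\<omega>. restrict \<omega> J) -` B' \<inter> space P)
            * P.prob ((\<lambda>\<omega>. restrict \<omega> (f ` J)) -` C \<inter> space P)"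
      proof (rule P.indep_varD[OF _ J(2) C])
        show "P.indep_var (PiM J (\<lambda>_. N)) (\<lambda>\<omega>. restrict \<omega> J)
            (PiM (f ` J) (\<lambda>_. N)) (\<lambda>\<omega>. restrict \<omega> (f ` J))"
          unfolding P_def using f(2) N by (intro indep_coordinate_blocks) auto
      qed
      moreover have "(\<lambda>\<omega>. (restrict \<omega> J, restrict \<omega> (f ` J))) -` (B' \<times> C) \<inter> space P = B \<inter> T B"
        using B_eq TB_eq by blast
      ultimately show ?thesis unfolding B_eq[symmetric] TB_eq[symmetric] by simp
    qed
    have AB: "P.prob (sym_diff A B) < \<epsilon> / 4" using close unfolding B_def .
    have "P.prob (sym_diff A (T B)) = P.prob (T (sym_diff A B))"
    proof (rule P.finite_measure_eq_AE)
      show "AE \<omega> in P. \<omega> \<in> sym_diff A (T B) \<longleftrightarrow> \<omega> \<in> T (sym_diff A B)"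
        using inv AE_space by eventually_elim (auto simp: T_def)
    qed (use A B T_meas in auto)
    also have "\<dots> = P.prob (sym_diff A B)" using A B by (intro T_prob) auto
    finally have ATB: "P.prob (sym_diff A (T B)) < \<epsilon> / 4" using AB by simp
    have "P.prob (sym_diff A (B \<inter> T B)) \<le> P.prob (sym_diff A B \<union> sym_diff A (T B))"
      using A B T_meas by (intro P.finite_measure_mono) auto
    also have "\<dots> \<le> P.prob (sym_diff A B) + P.prob (sym_diff A (T B))"
      using A B T_meas by (intro measure_Un_le) auto
    finally have "P.prob (sym_diff A (B \<inter> T B)) < \<epsilon> / 2" using AB ATB by simp
    then have 1: "\<bar>?p - (P.prob B)\<^sup>2\<bar> < \<epsilon> / 2"
      using sym_diff_prob_bounds[OF P.prob_space_axioms A, of "B \<inter> T B"] B T_meas indep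
        T_prob[OF B] by (auto simp: power2_eq_square)
    have 2: "\<bar>?p - P.prob B\<bar> < \<epsilon> / 4"
      using sym_diff_prob_bounds[OF P.prob_space_axioms A B] AB by linarith
    have "\<bar>?p\<^sup>2 - (P.prob B)\<^sup>2\<bar> = \<bar>?p - P.prob B\<bar> * \<bar>?p + P.prob B\<bar>"
      by (simp only: abs_mult[symmetric] power2_eq_square square_diff_square_factored mult.commute)
    also have "\<dots> \<le> \<epsilon> / 4 * 2"
      using 2 that P.prob_le_1[of A] P.prob_le_1[of B]
        measure_nonneg[of P A] measure_nonneg[of P B] by (intro mult_mono) linarith+
    finally show ?thesis using 1 by linarith
  qed
  have "?p = ?p\<^sup>2"
    using field_le_epsilon[of "\<bar>?p - ?p\<^sup>2\<bar>" 0] bound by simp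
  then show ?thesis by (auto simp: power2_eq_square)
qed

text \<open>A translation by more than the diameter of J moves J off itself.\<close>
lemma invariant_under_translations_prob_0_or_1:
  fixes N :: "'a measure" and A :: "(int \<Rightarrow> 'a) set"
  defines "P \<equiv> PiM UNIV (\<lambda>_. N)"
  assumes N: "prob_space N" and A: "A \<in> sets P"
    and inv: "\<And>n. AE \<omega> in P. (\<lambda>i. \<omega> (i - n)) \<in> A \<longleftrightarrow> \<omega> \<in> A"
  shows "measure P A = 0 \<or> measure P A = 1"
  unfolding P_def
proof (rule invariant_event_prob_0_or_1[OF N])
  show "A \<in> sets (PiM UNIV (\<lambda>_. N))" using A by (simp add: P_def)
  fix J :: "int set" assume J: "finite J"
  define b where "b = Max (insert 0 (abs ` J))"
  have b: "\<bar>j\<bar> \<le> b" if "j \<in> J" for j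
    unfolding b_def using J that by (intro Max_ge) auto
  \<comment> \<open>J lies in {-b..b}, which has diameter 2 * b.\<close>
  have "inj (\<lambda>i. i - (2 * b + 1))" by (simp add: inj_on_def)
  moreover have "(\<lambda>i. i - (2 * b + 1)) ` J \<inter> J = {}"
  proof -
    have "j - (2 * b + 1) \<notin> J" if "j \<in> J" for j
      using b[OF that] b[of "j - (2 * b + 1)"] by linarith
    then show ?thesis by auto
  qed
  ultimately show "\<exists>f. inj f \<and> f ` J \<inter> J = {} \<and>
      (AE \<omega> in PiM UNIV (\<lambda>_. N). (\<lambda>i. \<omega> (f i)) \<in> A \<longleftrightarrow> \<omega> \<in> A)"
    using inv[of "2 * b + 1"] unfolding P_def by blast
qed

section \<open>Balanced orientations from Schreier decorations\<close>

text \<open>At every vertex the colours put both the incoming and the outgoing edges in bijection with the d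
colours.\<close>
lemma balanced_of_schreier:
  assumes sch: "schreier V E d (c, h)" and c: "\<And>e. e \<in> E \<Longrightarrow> c e < d"
  shows "balanced V E h"
  unfolding balanced_def
proof
  fix v assume v: "v \<in> V"
  have inE: "in_edges E h v \<subseteq> E" and outE: "out_edges E h v \<subseteq> E"
    by (auto simp: in_edges_def out_edges_def incident_edges_def)
  have ex: "i < d \<Longrightarrow> \<exists>!e. e \<in> in_edges E h v \<and> c e = i"
    "i < d \<Longrightarrow> \<exists>!e. e \<in> out_edges E h v \<and> c e = i" for i
    using sch v by (auto simp: schreier_def)
  have "bij_betw c (in_edges E h v) {..<d}"
    unfolding bij_betw_def inj_on_def image_def using ex(1) inE c by (safe; blast)
  moreover have "bij_betw c (out_edges E h v) {..<d}"
    unfolding bij_betw_def inj_on_def image_def using ex(2) outE c by (safe; blast)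
  ultimately show "card (in_edges E h v) = card (out_edges E h v)"
    using bij_betw_same_card by metis
qed

lemma balanced_factor_of_schreier_factor:
  assumes "has_factor_of_iid_schreier_decoration V E d"
  shows "has_factor_of_iid_balanced_orientation V E"
proof -
  let ?C = "PiM E (\<lambda>_. count_space {..<d})"
  obtain X \<Phi> where fac:
      "is_factor_of_iid V E (schreier_decoration_space V E d) (act_decoration V E) X \<Phi>"
    using assms unfolding has_factor_of_iid_schreier_decoration_def by blast
  then have \<Phi>: "\<Phi> \<in> measurable (restrict_space (iid_labels V) X) (schreier_decoration_space V E d)"
    by (simp add: is_factor_of_iid_def)
  have "snd \<in> measurable (schreier_decoration_space V E d) (balanced_orientation_space V E)"
    unfolding schreier_decoration_space_def balanced_orientation_space_def
  proof (rule measurable_restrict_space2)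
    show "snd \<in> measurable (restrict_space (?C \<Otimes>\<^sub>M orientation_space E) {s. schreier V E d s})
        (orientation_space E)"
      by (intro measurable_restrict_space1) simp
    show "snd \<in> space (restrict_space (?C \<Otimes>\<^sub>M orientation_space E) {s. schreier V E d s})
        \<rightarrow> {h. balanced V E h}"
    proof
      fix s assume "s \<in> space (restrict_space (?C \<Otimes>\<^sub>M orientation_space E) {s. schreier V E d s})"
      then have "schreier V E d (fst s, snd s)" "\<And>e. e \<in> E \<Longrightarrow> fst s e < d"
        by (auto simp: space_restrict_space space_pair_measure space_PiM PiE_iff)
      then show "snd s \<in> {h. balanced V E h}" using balanced_of_schreier by blast
    qed
  qed
  from measurable_compose[OF \<Phi> this]
  have "is_factor_of_iid V E (balanced_orientation_space V E) (act_orientation V E) X (\<lambda>\<omega>. snd (\<Phi> \<omega>))"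
    unfolding is_factor_of_iid_def
  proof (intro conjI ballI)
    fix \<gamma> assume "\<gamma> \<in> graph_automorphisms V E"
    then have "AE \<omega> in iid_labels V. act_decoration V E \<gamma> (\<Phi> \<omega>) = \<Phi> (act_label V \<gamma> \<omega>)"
      using fac by (simp add: is_factor_of_iid_def)
    then show "AE \<omega> in iid_labels V. act_orientation V E \<gamma> (snd (\<Phi> \<omega>)) = snd (\<Phi> (act_label V \<gamma> \<omega>))"
      by eventually_elim (metis act_decoration_def snd_map_prod)
  qed (use fac in \<open>auto simp: is_factor_of_iid_def\<close>)
  then show ?thesis unfolding has_factor_of_iid_balanced_orientation_def by blast
qed

section \<open>Cayley graphs of the integers\<close>

definition int_cayley_edges :: "int set \<Rightarrow> int set set" where
  "int_cayley_edges S = {{x, x + s} | x s. s \<in> S}"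

lemma doubleton_mem_int_cayley_edges:
  "{u, v} \<in> int_cayley_edges S \<longleftrightarrow> v - u \<in> S \<or> u - v \<in> S"
proof
  assume "{u, v} \<in> int_cayley_edges S"
  then show "v - u \<in> S \<or> u - v \<in> S"
    by (auto simp: int_cayley_edges_def doubleton_eq_iff)
next
  assume "v - u \<in> S \<or> u - v \<in> S"
  moreover have "{u, v} = {u, u + (v - u)}" "{u, v} = {v, v + (u - v)}" by auto
  ultimately show "{u, v} \<in> int_cayley_edges S"
    unfolding int_cayley_edges_def by blast
qed

lemma int_cayley_edgeI: "s \<in> S \<Longrightarrow> {x, x + s} \<in> int_cayley_edges S"
  by (simp add: doubleton_mem_int_cayley_edges)

text \<open>The edges at v are indexed by the signed steps leading away from v; degrees and the balance
condition are both computed through this indexing.\<close>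
lemma incident_edges_int_cayley:
  "incident_edges (int_cayley_edges S) v = (\<lambda>t. {v, v + t}) ` (S \<union> uminus ` S)"
proof (intro equalityI subsetI)
  fix e assume "e \<in> incident_edges (int_cayley_edges S) v"
  then obtain x s where s: "s \<in> S" and e: "e = {x, x + s}" "v \<in> {x, x + s}"
    by (auto simp: incident_edges_def int_cayley_edges_def)
  then consider "v = x" | "v = x + s" by auto
  then show "e \<in> (\<lambda>t. {v, v + t}) ` (S \<union> uminus ` S)"
  proof cases
    case 1
    with s e show ?thesis by (intro image_eqI[of _ _ s]) auto
  next
    case 2
    with s e show ?thesis by (intro image_eqI[of _ _ "- s"]) auto
  qed
next
  fix e assume "e \<in> (\<lambda>t. {v, v + t}) ` (S \<union> uminus ` S)"
  then show "e \<in> incident_edges (int_cayley_edges S) v"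
    by (auto simp: incident_edges_def doubleton_mem_int_cayley_edges)
qed

lemma inj_on_edge_from: "inj_on (\<lambda>t. {v, v + t}) (T :: int set)"
  by (auto simp: inj_on_def doubleton_eq_iff)

lemma disjoint_negatives:
  assumes "S \<subseteq> {0 :: int<..}"
  shows "S \<inter> uminus ` S = {}"
proof -
  have "uminus ` S \<subseteq> {..<0}" using assms by auto
  then show ?thesis using assms by fastforce
qed

lemma simple_int_cayley:
  assumes "S \<subseteq> {0<..}"
  shows "simple_graph UNIV (int_cayley_edges S)"
  using assms by (force simp: simple_graph_def int_cayley_edges_def card_insert_if)

lemma regular_int_cayley:
  assumes S: "finite S" "S \<subseteq> {0<..}"
  shows "regular_graph UNIV (int_cayley_edges S) (2 * card S)"
proof -
  have "S \<inter> uminus ` S = {}" using S(2) by (rule disjoint_negatives)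
  then have "card (S \<union> uminus ` S) = 2 * card S"
    using S(1) by (simp add: card_Un_disjoint card_image)
  then show ?thesis
    using S(1) by (simp add: regular_graph_def incident_edges_int_cayley card_image[OF inj_on_edge_from])
qed

lemma connected_int_cayley:
  assumes "1 \<in> S"
  shows "connected_graph UNIV (int_cayley_edges S)"
proof -
  let ?R = "{(x, y). {x, y} \<in> int_cayley_edges S}"
  have up: "(u, u + int k) \<in> ?R\<^sup>*" for u k
  proof (induction k)
    case (Suc k)
    have "(u + int k, u + int (Suc k)) \<in> ?R"
      using assms by (simp add: doubleton_mem_int_cayley_edges)
    with Suc show ?case by (rule rtrancl_into_rtrancl)
  qed simp
  have "sym ?R" by (auto simp: sym_def insert_commute)
  then have sym: "sym (?R\<^sup>*)" by (rule sym_rtrancl)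
  have "(u, v) \<in> ?R\<^sup>*" for u v
  proof (cases "u \<le> v")
    case True
    with up[of u "nat (v - u)"] show ?thesis by simp
  next
    case False
    with up[of v "nat (u - v)"] have "(v, u) \<in> ?R\<^sup>*" by simp
    with sym show ?thesis by (rule symD)
  qed
  then show ?thesis by (simp add: connected_graph_def)
qed

lemma translation_automorphism: "(\<lambda>x. x + n) \<in> graph_automorphisms UNIV (int_cayley_edges S)"
proof -
  have "bij (\<lambda>x. x + n)" by (rule bij_betw_byWitness[where f' = "\<lambda>x. x - n"]) auto
  then show ?thesis by (simp add: graph_automorphisms_def doubleton_mem_int_cayley_edges)
qed

lemma reflection_automorphism: "uminus \<in> graph_automorphisms UNIV (int_cayley_edges S)"
proof -
  have "bij (uminus :: int \<Rightarrow> int)" by (rule bij_betw_byWitness[where f' = uminus]) auto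
  then show ?thesis by (auto simp: graph_automorphisms_def doubleton_mem_int_cayley_edges)
qed

lemma vertex_transitive_int_cayley: "vertex_transitive UNIV (int_cayley_edges S)"
  unfolding vertex_transitive_def
proof (intro ballI)
  fix u v :: int
  show "\<exists>\<gamma>\<in>graph_automorphisms UNIV (int_cayley_edges S). \<gamma> u = v"
    by (rule bexI[OF _ translation_automorphism[of "v - u"]]) simp
qed

lemma inv_translation: "inv (\<lambda>x. x + n) = (\<lambda>x :: int. x - n)"
  by (rule inv_equality) auto

lemma inv_reflection: "inv uminus = (uminus :: int \<Rightarrow> int)"
  by (rule inv_equality) auto

section \<open>The flow of an orientation\<close>

text \<open>For s > 0 this is 1 if the edge between x and x + s points to the right and -1 if it points to the
left.\<close>
definition edge_flow :: "(int set \<Rightarrow> int) \<Rightarrow> int \<Rightarrow> int \<Rightarrow> int" where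
  "edge_flow h x s = (if h {x, x + s} = x + s then 1 else - 1)"

text \<open>The edges of step s that cross from the integers up to n to those above n are the ones with left
endpoint in {n - s<..n}, so this is the net flow to the right through that cut.\<close>
definition flow :: "int set \<Rightarrow> (int set \<Rightarrow> int) \<Rightarrow> int \<Rightarrow> int" where
  "flow S h n = (\<Sum>s\<in>S. \<Sum>x\<in>{n - s<..n}. edge_flow h x s)"

text \<open>Kirchhoff's law at v: what flows out to the right equals what comes in from the left. Weighting
each edge at v by 1 if it enters v and by -1 otherwise, the total weight is indegree minus
outdegree, hence 0; an edge to the right of v has weight opposite to its flow, an edge to the left
has weight equal to its flow.\<close>
lemma balanced_edge_flow:
  assumes S: "finite S" "S \<subseteq> {0<..}"
    and h: "\<And>e. e \<in> int_cayley_edges S \<Longrightarrow> h e \<in> e"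
    and bal: "balanced UNIV (int_cayley_edges S) h"
  shows "(\<Sum>s\<in>S. edge_flow h v s) = (\<Sum>s\<in>S. edge_flow h (v - s) s)"
proof -
  let ?E = "int_cayley_edges S"
  let ?w = "\<lambda>e. if h e = v then 1 else - 1 :: int"
  have fin: "finite (incident_edges ?E v)" using S(1) by (simp add: incident_edges_int_cayley)
  have "(\<Sum>e\<in>incident_edges ?E v. ?w e) = int (card (in_edges ?E h v)) - int (card (out_edges ?E h v))"
    using fin by (simp add: sum.If_cases in_edges_def out_edges_def Int_def Collect_neg_eq)
  also have "\<dots> = 0" using bal by (simp add: balanced_def)
  finally have "0 = (\<Sum>e\<in>incident_edges ?E v. ?w e)" by simp
  also have "\<dots> = (\<Sum>t\<in>S \<union> uminus ` S. ?w {v, v + t})"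
    by (simp add: incident_edges_int_cayley sum.reindex[OF inj_on_edge_from])
  also have "\<dots> = (\<Sum>t\<in>S. ?w {v, v + t}) + (\<Sum>t\<in>uminus ` S. ?w {v, v + t})"
    using S disjoint_negatives[OF S(2)] by (intro sum.union_disjoint) auto
  also have "(\<Sum>t\<in>uminus ` S. ?w {v, v + t}) = (\<Sum>s\<in>S. ?w {v, v + (- s)})"
    by (simp add: sum.reindex)
  also have "(\<Sum>t\<in>S. ?w {v, v + t}) = (\<Sum>s\<in>S. - edge_flow h v s)"
  proof (rule sum.cong)
    fix s assume s: "s \<in> S"
    then have "h {v, v + s} \<in> {v, v + s}" by (intro h int_cayley_edgeI)
    then show "?w {v, v + s} = - edge_flow h v s" using s S(2) by (auto simp: edge_flow_def)
  qed simp
  also have "(\<Sum>s\<in>S. ?w {v, v + (- s)}) = (\<Sum>s\<in>S. edge_flow h (v - s) s)"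
    by (intro sum.cong) (auto simp: edge_flow_def insert_commute)
  finally show ?thesis by (simp add: sum_negf)
qed

text \<open>Moving the cut across the vertex m + 1 exchanges, for every step s, the edge entering m + 1 from the
left for the one leaving it to the right; by Kirchhoff's law the exchange is neutral.\<close>
lemma flow_const:
  assumes S: "finite S" "S \<subseteq> {0<..}"
    and h: "\<And>e. e \<in> int_cayley_edges S \<Longrightarrow> h e \<in> e"
    and bal: "balanced UNIV (int_cayley_edges S) h"
  shows "flow S h n = flow S h 0"
proof -
  have cut: "(\<Sum>x\<in>{m + 1 - s<..m + 1}. edge_flow h x s) + edge_flow h (m + 1 - s) s
      = (\<Sum>x\<in>{m - s<..m}. edge_flow h x s) + edge_flow h (m + 1) s" if "s \<in> S" for m s
  proof -
    have "0 < s" using that S(2) by auto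
    then have "insert (m + 1 - s) {m + 1 - s<..m + 1} = insert (m + 1) {m - s<..m}" by auto
    then have "(\<Sum>x\<in>insert (m + 1 - s) {m + 1 - s<..m + 1}. edge_flow h x s)
      = (\<Sum>x\<in>insert (m + 1) {m - s<..m}. edge_flow h x s)" by simp
    then show ?thesis by simp
  qed
  have step: "flow S h (m + 1) = flow S h m" for m
  proof -
    have "flow S h (m + 1) + (\<Sum>s\<in>S. edge_flow h (m + 1 - s) s)
        = flow S h m + (\<Sum>s\<in>S. edge_flow h (m + 1) s)"
      unfolding flow_def by (simp add: cut sum.distrib[symmetric])
    then show ?thesis using balanced_edge_flow[OF S h bal, of "m + 1"] by simp
  qed
  show ?thesis
  proof (induction n rule: int_induct[where k = 0])
    case (step2 i)
    then show ?case using step[of "i - 1"] by simp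
  qed (simp_all add: step)
qed

text \<open>The cut has s edges of step s, and each of them contributes 1 or -1, an odd number.\<close>
lemma odd_flow:
  assumes S: "S \<subseteq> {0<..}" and "odd (\<Sum>S)"
  shows "odd (flow S h n)"
proof -
  have "even (flow S h n + \<Sum>S)"
  proof -
    have "\<Sum>S = (\<Sum>s\<in>S. \<Sum>x\<in>{n - s<..n}. 1)"
      using S by (intro sum.cong) auto
    then have "flow S h n + \<Sum>S = (\<Sum>s\<in>S. \<Sum>x\<in>{n - s<..n}. edge_flow h x s + 1)"
      by (simp add: flow_def sum.distrib)
    also have "even \<dots>" by (intro dvd_sum) (auto simp: edge_flow_def)
    finally show ?thesis .
  qed
  with assms(2) show ?thesis by simp
qed

lemma flow_translation:
  "flow S (act_orientation UNIV (int_cayley_edges S) (\<lambda>x. x + n) h) m = flow S h (m - n)"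
proof -
  have "edge_flow (act_orientation UNIV (int_cayley_edges S) (\<lambda>x. x + n) h) x s = edge_flow h (x - n) s"
    if "s \<in> S" for x s
    using int_cayley_edgeI[OF that, of x]
    by (simp add: edge_flow_def act_orientation_def inv_translation algebra_simps)
  moreover have "(\<Sum>x\<in>{m - s<..m}. edge_flow h (x - n) s) = (\<Sum>x\<in>{m - n - s<..m - n}. edge_flow h x s)" for s
    by (rule sum.reindex_bij_witness[where i = "\<lambda>x. x + n" and j = "\<lambda>x. x - n"]) auto
  ultimately show ?thesis by (simp add: flow_def)
qed

text \<open>The reflection maps the cut between m and m + 1 to the one between - m - 1 and - m and swaps its two
sides. That every head is an endpoint of its edge is what makes an edge not pointing to the right
point to the left.\<close>
lemma flow_reflection:
  assumes S: "S \<subseteq> {0<..}" and h: "\<And>e. e \<in> int_cayley_edges S \<Longrightarrow> h e \<in> e"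
  shows "flow S (act_orientation UNIV (int_cayley_edges S) uminus h) m = - flow S h (- m - 1)"
proof -
  have "edge_flow (act_orientation UNIV (int_cayley_edges S) uminus h) x s = - edge_flow h (- x - s) s"
    if s: "s \<in> S" for x s
  proof -
    have "h {- x - s, - x - s + s} \<in> {- x - s, - x - s + s}"
      by (intro h int_cayley_edgeI s)
    moreover have "uminus ` {x, x + s} = {- x - s, - x - s + s}" by auto
    moreover have "0 < s" using s S by auto
    ultimately show ?thesis
      using int_cayley_edgeI[OF s, of x]
      by (auto simp: edge_flow_def act_orientation_def inv_reflection)
  qed
  moreover have "(\<Sum>x\<in>{m - s<..m}. edge_flow h (- x - s) s)
      = (\<Sum>x\<in>{- m - 1 - s<..- m - 1}. edge_flow h x s)" for s
    by (rule sum.reindex_bij_witness[where i = "\<lambda>x. - x - s" and j = "\<lambda>x. - x - s"]) auto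
  ultimately show ?thesis by (simp add: flow_def sum_negf)
qed

section \<open>Parity excludes factors of iid\<close>

lemma measurable_flow:
  assumes "\<And>e. e \<in> int_cayley_edges S \<Longrightarrow> (\<lambda>\<omega>. \<Phi> \<omega> e) \<in> measurable R (count_space e)"
  shows "(\<lambda>\<omega>. real_of_int (flow S (\<Phi> \<omega>) n)) \<in> borel_measurable R"
proof -
  have "(\<lambda>\<omega>. real_of_int (edge_flow (\<Phi> \<omega>) x s)) \<in> borel_measurable R" if "s \<in> S" for x s
  proof -
    have "(\<lambda>y. if y = x + s then 1 else - 1 :: real) \<in> borel_measurable (count_space {x, x + s})"
      by simp
    note measurable_compose[OF assms[OF int_cayley_edgeI[OF that, of x]] this]
    moreover have "real_of_int (edge_flow h x s) = (if h {x, x + s} = x + s then 1 else - 1)" for h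
      by (simp add: edge_flow_def)
    ultimately show ?thesis by presburger
  qed
  then show ?thesis unfolding flow_def of_int_sum by (intro borel_measurable_sum) auto
qed

text \<open>The event A that the orientation flows to the right has probability 0 or 1 by invariance under
translations, and probability 1/2 by its exchange with the complement under the reflection.\<close>
lemma no_balanced_factor_int_cayley:
  assumes S: "finite S" "S \<subseteq> {0<..}" and odd: "odd (\<Sum>S)"
  shows "\<not> has_factor_of_iid_balanced_orientation UNIV (int_cayley_edges S)"
proof
  let ?E = "int_cayley_edges S"
  let ?act = "act_orientation UNIV ?E"
  define N where "N = restrict_space lborel {0..1 :: real}"
  have N: "prob_space N"
    unfolding N_def by (rule prob_space_restrict_space) simp_all
  define P where "P = PiM (UNIV :: int set) (\<lambda>_. N)"
  have labels: "iid_labels UNIV = P" by (simp add: iid_labels_def P_def N_def)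
  interpret P: prob_space P unfolding P_def by (rule prob_space_PiM) (rule N)
  assume "has_factor_of_iid_balanced_orientation UNIV ?E"
  then obtain X \<Phi> where
      fac: "is_factor_of_iid UNIV ?E (balanced_orientation_space UNIV ?E) ?act X \<Phi>"
    unfolding has_factor_of_iid_balanced_orientation_def by (elim exE)
  have X: "X \<in> sets P" "AE \<omega> in P. \<omega> \<in> X"
    and \<Phi>: "\<Phi> \<in> measurable (restrict_space P X) (balanced_orientation_space UNIV ?E)"
    using fac unfolding is_factor_of_iid_def labels by simp_all
  have equiv: "AE \<omega> in P. ?act \<gamma> (\<Phi> \<omega>) = \<Phi> (act_label UNIV \<gamma> \<omega>)"
    if "\<gamma> \<in> graph_automorphisms UNIV ?E" for \<gamma>
    using fac that unfolding is_factor_of_iid_def labels by simp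
  let ?R = "restrict_space P X"
  have \<Phi>_or: "\<Phi> \<in> measurable ?R (PiM ?E (\<lambda>e. count_space e))"
    and \<Phi>_bal: "\<Phi> \<in> space ?R \<rightarrow> {h. balanced UNIV ?E h}"
    using \<Phi> unfolding balanced_orientation_space_def orientation_space_def
    by (auto simp: measurable_restrict_space2_iff)
  have "X \<subseteq> space P" using X(1) by (rule sets.sets_into_space)
  then have space_R: "space ?R = X" by (auto simp: space_restrict_space)
  have bal: "balanced UNIV ?E (\<Phi> \<omega>)" if "\<omega> \<in> X" for \<omega>
    using \<Phi>_bal that by (auto simp: space_R)
  have head: "\<Phi> \<omega> e \<in> e" if "\<omega> \<in> X" "e \<in> ?E" for \<omega> e
    using measurable_space[OF \<Phi>_or, of \<omega>] that by (auto simp: space_R space_PiM PiE_iff)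
  define A where "A = {\<omega> \<in> X. 0 < flow S (\<Phi> \<omega>) 0}"
  have A: "A \<in> sets P"
  proof -
    have "(\<lambda>\<omega>. real_of_int (flow S (\<Phi> \<omega>) 0)) \<in> borel_measurable ?R"
      using measurable_compose[OF \<Phi>_or measurable_component_singleton] by (intro measurable_flow) auto
    then have "{\<omega> \<in> space ?R. 0 < real_of_int (flow S (\<Phi> \<omega>) 0)} \<in> sets ?R" by measurable
    also have "{\<omega> \<in> space ?R. 0 < real_of_int (flow S (\<Phi> \<omega>) 0)} = A" by (simp add: space_R A_def)
    finally show ?thesis using X(1) by (simp add: sets_restrict_space_iff)
  qed
  have act: "act_label UNIV \<gamma> = (\<lambda>\<omega> i. \<omega> (inv \<gamma> i))" for \<gamma> :: "int \<Rightarrow> int"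
    by (simp add: act_label_def fun_eq_iff)
  \<comment> \<open>A relabelled \<omega> is judged by the sign of its flow only if it still lies in X, as it almost
    surely does.\<close>
  have moved: "AE \<omega> in P. (\<lambda>i. \<omega> (f i)) \<in> X" if "inj f" for f
  proof (rule AE_distrD[where f = "\<lambda>\<omega> i. \<omega> (f i)" and M' = P and P = "\<lambda>\<omega>. \<omega> \<in> X"])
    show "(\<lambda>\<omega> i. \<omega> (f i)) \<in> measurable P P"
      unfolding P_def by (rule measurable_relabel)
    have "distr P P (\<lambda>\<omega> i. \<omega> (f i)) = P"
      unfolding P_def by (rule distr_PiM_relabel[OF N that])
    then show "AE \<omega> in distr P P (\<lambda>\<omega> i. \<omega> (f i)). \<omega> \<in> X" by (rule ssubst) (rule X(2))
  qed
  have inv: "AE \<omega> in P. (\<lambda>i. \<omega> (i - n)) \<in> A \<longleftrightarrow> \<omega> \<in> A" for n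
  proof -
    have "AE \<omega> in P. (\<lambda>i. \<omega> (i - n)) \<in> X" by (rule moved) (simp add: inj_on_def)
    moreover have "AE \<omega> in P. ?act (\<lambda>x. x + n) (\<Phi> \<omega>) = \<Phi> (\<lambda>i. \<omega> (i - n))"
      using equiv[OF translation_automorphism] by (simp add: act inv_translation)
    ultimately show ?thesis
      using X(2)
    proof eventually_elim
      case (elim \<omega>)
      have "flow S (\<Phi> (\<lambda>i. \<omega> (i - n))) 0 = flow S (\<Phi> \<omega>) (0 - n)"
        unfolding elim(2)[symmetric] by (rule flow_translation)
      also have "\<dots> = flow S (\<Phi> \<omega>) 0"
        using elim(3) by (intro flow_const S head bal)
      finally show ?case using elim by (simp add: A_def)
    qed
  qed
  have "P.prob A = 0 \<or> P.prob A = 1"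
    by (rule invariant_under_translations_prob_0_or_1[OF N, folded P_def, OF A inv])
  moreover have "P.prob A = P.prob (space P - A)"
  proof -
    have "AE \<omega> in P. (\<lambda>i. \<omega> (- i)) \<in> X" by (rule moved) (simp add: inj_on_def)
    moreover have "AE \<omega> in P. ?act uminus (\<Phi> \<omega>) = \<Phi> (\<lambda>i. \<omega> (- i))"
      using equiv[OF reflection_automorphism] by (simp add: act inv_reflection)
    ultimately have flip: "AE \<omega> in P. (\<lambda>i. \<omega> (- i)) \<in> A \<longleftrightarrow> \<omega> \<notin> A"
      using X(2)
    proof eventually_elim
      case (elim \<omega>)
      have "flow S (\<Phi> (\<lambda>i. \<omega> (- i))) 0 = - flow S (\<Phi> \<omega>) (- 0 - 1)"
        unfolding elim(2)[symmetric] using elim(3) by (intro flow_reflection S head)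
      also have "flow S (\<Phi> \<omega>) (- 0 - 1) = flow S (\<Phi> \<omega>) 0"
        using elim(3) by (intro flow_const S head bal)
      finally have "flow S (\<Phi> (\<lambda>i. \<omega> (- i))) 0 = - flow S (\<Phi> \<omega>) 0" .
      moreover have "flow S (\<Phi> \<omega>) 0 \<noteq> 0" using odd_flow[OF S(2) odd, of "\<Phi> \<omega>" 0] by auto
      ultimately show ?case using elim by (auto simp: A_def)
    qed
    have "P.prob A = P.prob {\<omega> \<in> space P. (\<lambda>i. \<omega> (- i)) \<in> A}"
      using measure_relabel[OF N, of uminus A] A unfolding P_def by (simp add: inj_on_def)
    also have "\<dots> = P.prob (space P - A)"
    proof (rule P.finite_measure_eq_AE)
      show "AE \<omega> in P. \<omega> \<in> {\<omega> \<in> space P. (\<lambda>i. \<omega> (- i)) \<in> A} \<longleftrightarrow> \<omega> \<in> space P - A"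
        using flip AE_space by eventually_elim auto
      show "{\<omega> \<in> space P. (\<lambda>i. \<omega> (- i)) \<in> A} \<in> sets P"
        using A unfolding P_def by (rule sets_relabel)
    qed (use A in auto)
    finally show ?thesis .
  qed
  ultimately show False using P.prob_compl[OF A] by linarith
qed

theorem theorem1p3:
  fixes d :: nat
  assumes "d \<ge> 1"
  shows "\<exists>(V :: int set) (E :: int set set).
    simple_graph V E \<and> connected_graph V E \<and> regular_graph V E (2 * d) \<and> vertex_transitive V E \<and>
    \<not> has_factor_of_iid_balanced_orientation V E \<and>
    \<not> has_factor_of_iid_schreier_decoration V E d"
proof -
  \<comment> \<open>The step 1 makes the graph connected and the sum of the steps odd; the even steps raise the
    degree to 2 * d without changing the parity.\<close>
  define T where "T = (\<lambda>k. 2 * int k) ` {1..<d}"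
  define S where "S = insert 1 T"
  have T: "finite T" "1 \<notin> T" "card T = d - 1" "even (\<Sum>T)"
    by (auto simp: T_def card_image inj_on_def sum.reindex intro!: dvd_sum) presburger
  then have S: "finite S" "S \<subseteq> {0<..}" "card S = d" "odd (\<Sum>S)" "1 \<in> S"
    using assms by (auto simp: S_def T_def)
  have "\<not> has_factor_of_iid_balanced_orientation UNIV (int_cayley_edges S)"
    using S by (intro no_balanced_factor_int_cayley) auto
  moreover from this have "\<not> has_factor_of_iid_schreier_decoration UNIV (int_cayley_edges S) d"
    using balanced_factor_of_schreier_factor by blast
  ultimately show ?thesis
    using S simple_int_cayley connected_int_cayley regular_int_cayley[OF S(1,2)]
      vertex_transitive_int_cayley[of S]
    by (intro exI[of _ UNIV] exI[of _ "int_cayley_edges S"]) simp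
qed

end
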